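(* For $m\ge2$, let $Q_{4m}=\langle a,b\mid a^{2m}=e,\ b^2=a^m,\ b^{-1}ab=a^{-1}\rangle$ be the generalized quaternion group of order $4m$. In the directed Cayley graph $\Gamma(Q_{4m},\{a,a^{-1},b\})$ the Lin--Lu--Yau Ricci curvatures of the arcs $(e,a)$ and $(e,b)$ are $$\kappa(e,a)=\begin{cases}\tfrac23,& m=2,\\ \tfrac13,& m=3,\\ 0,& m\ge4,\end{cases}\qquad \kappa(e,b)=0\ \text{ for all } m\ge2.$$
   Context: For a group $G$ with identity $e$ and a finite set $S\subseteq G\setminus\{e\}$, the directed Cayley graph $\Gamma(G,S)$ has vertex set $G$ and arcs $(g,gs)$ for $g\in G$, $s\in S$. In a simple directed graph $(V,\mathcal A)$, $N^{\rm out}(x)=\{v\in V:(x,v)\in\mathcal A\}$, $d^{\rm out}_x=|N^{\rm out}(x)|$, and $d(x,y)$ is the length of a shortest directed path from $x$ to $y$. For $\alpha\in[0,1]$, the $\alpha$-lazy random walk measure at $x$ is $\mu^\alpha_x(x)=\alpha$, $\mu^\alpha_x(v)=\frac{1-\alpha}{d^{\rm out}_x}$ if $(x,v)\in\mathcal A$, and $\mu_x^\alpha(v)=0$ otherwise. For probability measures $\mu,\nu$ on $V$, $W(\mu,\nu)=\inf_A\sum_{u,v\in V}A(u,v)d(u,v)$, the infimum over couplings $A:V\times V\to[0,1]$ with $\sum_{v}A(u,v)=\mu(u)$ for all $u$ and $\sum_uA(u,v)=\nu(v)$ for all $v$. For distinct $x,y$, $\kappa_\alpha(x,y)=1-\frac{W(\mu_x^\alpha,\mu_y^\alpha)}{d(x,y)}$,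 and the Lin--Lu--Yau Ricci curvature is $\kappa(x,y)=\lim_{\alpha\to1^-}\frac{\kappa_\alpha(x,y)}{1-\alpha}$. *)

theory Defs
  imports "HOL-Analysis.Infinite_Sum" "HOL-Library.Extended_Real" "HOL-Algebra.Group"
    "Graph_Theory.Graph_Theory"
begin

section \<open>Groups given by generators and relations\<close>

text \<open>
  A word is a list of letters; the letter \<open>(x, False)\<close> stands for the generator \<open>x\<close> and
  \<open>(x, True)\<close> for its formal inverse. A relation \<open>u = v\<close> is given as the pair \<open>(u, v)\<close>. The
  group presented by \<open>R\<close> consists of the words modulo the smallest congruence for concatenation
  that contains \<open>R\<close> and cancels a letter against its formal inverse.
\<close>

type_synonym 'x word = "('x \<times> bool) list"

inductive pres_eq :: "('x word \<times> 'x word) set \<Rightarrow> 'x word \<Rightarrow> 'x word \<Rightarrow> bool"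
  for R :: "('x word \<times> 'x word) set"
where
  pres_refl: "pres_eq R u u"
| pres_sym: "pres_eq R u v \<Longrightarrow> pres_eq R v u"
| pres_trans: "pres_eq R u v \<Longrightarrow> pres_eq R v w \<Longrightarrow> pres_eq R u w"
| pres_append: "pres_eq R u u' \<Longrightarrow> pres_eq R v v' \<Longrightarrow> pres_eq R (u @ v) (u' @ v')"
| pres_cancel: "pres_eq R [(x, s), (x, \<not> s)] []"
| pres_rel: "(u, v) \<in> R \<Longrightarrow> pres_eq R u v"

definition pres_class :: "('x word \<times> 'x word) set \<Rightarrow> 'x word \<Rightarrow> 'x word set" where
  "pres_class R u = {v. pres_eq R u v}"

definition presented_group :: "('x word \<times> 'x word) set \<Rightarrow> 'x word set monoid" where
  "presented_group R =
     \<lparr> carrier = range (pres_class R),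
       mult = (\<lambda>X Y. {w. \<exists>u\<in>X. \<exists>v\<in>Y. pres_eq R (u @ v) w}),
       one = pres_class R [] \<rparr>"

lemma pres_class_eq_iff: "pres_class R u = pres_class R v \<longleftrightarrow> pres_eq R u v"
  unfolding pres_class_def by (auto intro: pres_refl pres_sym pres_trans)

lemma presented_group_simps:
  "carrier (presented_group R) = range (pres_class R)"
  "\<one>\<^bsub>presented_group R\<^esub> = pres_class R []"
  by (simp_all add: presented_group_def)

lemma presented_group_mult:
  "pres_class R u \<otimes>\<^bsub>presented_group R\<^esub> pres_class R v = pres_class R (u @ v)"
  unfolding presented_group_def pres_class_def
  by (auto intro: pres_refl pres_trans pres_append)

definition inv_word :: "'x word \<Rightarrow> 'x word" where
  "inv_word u = rev (map (\<lambda>(x, s). (x, \<not> s)) u)"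

lemma pres_eq_inv_word: "pres_eq R (inv_word u @ u) []"
proof (induction u)
  case Nil
  show ?case by (simp add: inv_word_def pres_refl)
next
  case (Cons l u)
  obtain x s where l: "l = (x, s)" by (cases l)
  have "pres_eq R [(x, \<not> s), (x, s)] []"
    using pres_cancel[of R x "\<not> s"] by simp
  then have "pres_eq R (inv_word u @ [(x, \<not> s), (x, s)] @ u) (inv_word u @ [] @ u)"
    by (intro pres_append pres_refl)
  then show ?case
    using Cons.IH by (auto simp: inv_word_def l intro: pres_trans)
qed

lemma group_presented_group: "group (presented_group R)"
proof (rule groupI)
  fix x assume "x \<in> carrier (presented_group R)"
  then obtain u where "x = pres_class R u" by (auto simp: presented_group_simps)
  then have "pres_class R (inv_word u) \<otimes>\<^bsub>presented_group R\<^esub> x = \<one>\<^bsub>presented_group R\<^esub>"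
    by (simp add: presented_group_mult presented_group_simps pres_class_eq_iff pres_eq_inv_word)
  then show "\<exists>y\<in>carrier (presented_group R). y \<otimes>\<^bsub>presented_group R\<^esub> x = \<one>\<^bsub>presented_group R\<^esub>"
    by (auto simp: presented_group_simps)
qed (auto simp: presented_group_simps presented_group_mult)


section \<open>The generalized quaternion group\<close>

datatype quat_gen = Gen_a | Gen_b

abbreviation word_a :: "quat_gen word" where "word_a \<equiv> [(Gen_a, False)]"
abbreviation word_a_inv :: "quat_gen word" where "word_a_inv \<equiv> [(Gen_a, True)]"
abbreviation word_b :: "quat_gen word" where "word_b \<equiv> [(Gen_b, False)]"
abbreviation word_b_inv :: "quat_gen word" where "word_b_inv \<equiv> [(Gen_b, True)]"

definition quat_relations :: "nat \<Rightarrow> (quat_gen word \<times> quat_gen word) set" where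
  "quat_relations m =
     {(concat (replicate (2 * m) word_a), []),
      (word_b @ word_b, concat (replicate m word_a)),
      (word_b_inv @ word_a @ word_b, word_a_inv)}"

definition quaternion_group :: "nat \<Rightarrow> quat_gen word set monoid" where
  "quaternion_group m = presented_group (quat_relations m)"

definition quat_a :: "nat \<Rightarrow> quat_gen word set" where
  "quat_a m = pres_class (quat_relations m) word_a"

definition quat_b :: "nat \<Rightarrow> quat_gen word set" where
  "quat_b m = pres_class (quat_relations m) word_b"

lemma group_quaternion_group: "group (quaternion_group m)"
  by (simp add: quaternion_group_def group_presented_group)

lemma quat_gens_in_carrier:
  "quat_a m \<in> carrier (quaternion_group m)" "quat_b m \<in> carrier (quaternion_group m)"
  by (auto simp: quat_a_def quat_b_def quaternion_group_def presented_group_simps)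


section \<open>Directed Cayley graphs\<close>

text \<open>This is the paper-and-pencil notion when \<open>S\<close> is a finite subset of
  \<open>carrier G - {\<one>\<^bsub>G\<^esub>}\<close>.\<close>

definition cayley_digraph :: "('g, 'r) monoid_scheme \<Rightarrow> 'g set \<Rightarrow> 'g pair_pre_digraph" where
  "cayley_digraph G S =
     \<lparr> pverts = carrier G, parcs = {(g, g \<otimes>\<^bsub>G\<^esub> s) | g s. g \<in> carrier G \<and> s \<in> S} \<rparr>"


section \<open>Lin--Lu--Yau curvature of a simple digraph\<close>

definition out_nbrs :: "'v pair_pre_digraph \<Rightarrow> 'v \<Rightarrow> 'v set" where
  "out_nbrs D x = {v \<in> pverts D. (x, v) \<in> parcs D}"

text \<open>The distance is \<open>\<infinity>\<close> if there is no directed path from \<open>x\<close> to \<open>y\<close>.\<close>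

definition ddist :: "'v pair_pre_digraph \<Rightarrow> 'v \<Rightarrow> 'v \<Rightarrow> ereal" where
  "ddist D x y = (INF p \<in> {p. pre_digraph.apath (with_proj D) x p y}. ereal (real (length p)))"

definition lazy_walk :: "'v pair_pre_digraph \<Rightarrow> real \<Rightarrow> 'v \<Rightarrow> 'v \<Rightarrow> real" where
  "lazy_walk D \<alpha> x v =
     (if v = x then \<alpha>
      else if (x, v) \<in> parcs D then (1 - \<alpha>) / real (card (out_nbrs D x))
      else 0)"

definition is_coupling :: "'v set \<Rightarrow> ('v \<Rightarrow> real) \<Rightarrow> ('v \<Rightarrow> real) \<Rightarrow> ('v \<Rightarrow> 'v \<Rightarrow> real) \<Rightarrow> bool" where
  "is_coupling V \<mu> \<nu> A \<longleftrightarrow>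
     (\<forall>u\<in>V. \<forall>v\<in>V. 0 \<le> A u v \<and> A u v \<le> 1) \<and>
     (\<forall>u\<in>V. ((\<lambda>v. A u v) has_sum \<mu> u) V) \<and>
     (\<forall>v\<in>V. ((\<lambda>u. A u v) has_sum \<nu> v) V)"

text \<open>The cost of a coupling is a sum of nonnegative extended reals, hence always meaningful
  (with \<open>0 * \<infinity> = 0\<close>).\<close>

definition wasserstein :: "'v pair_pre_digraph \<Rightarrow> ('v \<Rightarrow> real) \<Rightarrow> ('v \<Rightarrow> real) \<Rightarrow> ereal" where
  "wasserstein D \<mu> \<nu> =
     (INF A \<in> {A. is_coupling (pverts D) \<mu> \<nu> A}.
        (\<Sum>\<^sub>\<infinity>(u, v) \<in> pverts D \<times> pverts D. ereal (A u v) * ddist D u v))"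

definition lazy_curvature :: "'v pair_pre_digraph \<Rightarrow> real \<Rightarrow> 'v \<Rightarrow> 'v \<Rightarrow> ereal" where
  "lazy_curvature D \<alpha> x y =
     1 - wasserstein D (lazy_walk D \<alpha> x) (lazy_walk D \<alpha> y) / ddist D x y"

text \<open>\<open>has_lly_curvature D x y k\<close> says that the limit defining \<open>\<kappa>(x, y)\<close> exists and is \<open>k\<close>.\<close>

definition has_lly_curvature :: "'v pair_pre_digraph \<Rightarrow> 'v \<Rightarrow> 'v \<Rightarrow> real \<Rightarrow> bool" where
  "has_lly_curvature D x y k \<longleftrightarrow>
     ((\<lambda>\<alpha>. lazy_curvature D \<alpha> x y / ereal (1 - \<alpha>)) \<longlongrightarrow> ereal k) (at_left 1)"

lemma has_lly_curvature_unique: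
  assumes "has_lly_curvature D x y k" "has_lly_curvature D x y k'"
  shows "k = k'"
  using assms tendsto_unique[of "at_left (1::real)"]
  unfolding has_lly_curvature_def by (metis ereal.inject trivial_limit_at_left_real)

end

theory Submission
  imports Defs
begin

text \<open>
  Let \<open>\<epsilon> = (1 - \<alpha>) / 3\<close>. For an arc \<open>(x, y)\<close> take a bijection \<open>\<sigma>\<close> between the closed out-balls of
  \<open>x\<close> and \<open>y\<close>, move mass \<open>\<epsilon>\<close> from each \<open>u\<close> to \<open>\<sigma> u\<close>, and send the remaining mass \<open>\<alpha> - \<epsilon>\<close> from \<open>x\<close>
  to \<open>y\<close>. By duality this is optimal once some potential \<open>f\<close>, growing by at most 1 along each arc,
  grows by the full distance along each of these moves; then
  \<open>\<kappa>(x, y) = 1 + (1 - (\<Sum>u. d(u, \<sigma> u))) / 3\<close>.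

  For \<open>(e, a)\<close> the moves are \<open>e \<rightarrow> e\<close>, \<open>a \<rightarrow> a\<close>, \<open>b \<rightarrow> ab\<close> (length 1, since \<open>ab = ba\<^sup>-\<^sup>1\<close>) and
  \<open>a\<^sup>-\<^sup>1 \<rightarrow> a\<^sup>2\<close>, whose length is 1, 2 or 3 as \<open>m = 2\<close>, \<open>m = 3\<close> (because \<open>a\<^sup>-\<^sup>1b\<^sup>2 = a\<^sup>2\<close>) or \<open>m \<ge> 4\<close>. For
  \<open>(e, b)\<close> they are \<open>b \<rightarrow> b\<close>, \<open>a \<rightarrow> ab\<close>, \<open>a\<^sup>-\<^sup>1 \<rightarrow> a\<^sup>-\<^sup>1b\<close> and \<open>e \<rightarrow> b\<^sup>2\<close>, of total length 4. Both potentials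
  have the form \<open>f(a\<^sup>i b\<^sup>j) = h(i) + j\<close> with \<open>h\<close> on the cycle of length \<open>2 * m\<close>; the arcs
  \<open>a\<^sup>i b \<rightarrow> a\<^sup>i\<^sup>+\<^sup>m\<close> require \<open>h(i + m) \<le> h(i) + 2\<close>.
\<close>

section \<open>Optimal transport on digraphs\<close>

text \<open>One-sided because the distance is directed: \<open>f\<close> may fall by any amount
  along an arc.\<close>

definition arc_lipschitz :: "'v pair_pre_digraph \<Rightarrow> ('v \<Rightarrow> real) \<Rightarrow> bool" where
  "arc_lipschitz D f \<longleftrightarrow> (\<forall>(u, v) \<in> parcs D. f v \<le> f u + 1)"

text \<open>The distance is an infimum over paths without repeated vertices, while upper bounds
  arise from arbitrary walks; cutting out cycles only shortens a walk.\<close>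

lemma (in wf_digraph) exists_shorter_apath:
  assumes "awalk u p v"
  shows "\<exists>q. apath u q v \<and> length q \<le> length p"
  using assms
proof (induct rule: awalk_to_apath_induct)
  case (path p)
  then show ?case by (auto simp: apath_def)
next
  case (decomp p q r s)
  then show ?case by (force elim!: awalk_cyc_decompE)
qed

lemma ddist_le_awalk_length:
  assumes "wf_digraph (with_proj D)" "pre_digraph.awalk (with_proj D) x p y"
  shows "ddist D x y \<le> ereal (real (length p))"
proof -
  obtain q where "pre_digraph.apath (with_proj D) x q y" "length q \<le> length p"
    using wf_digraph.exists_shorter_apath[OF assms] by blast
  then show ?thesis
    unfolding ddist_def by (intro INF_lower2[of q]) auto
qed

lemma arc_lipschitz_pcas:
  assumes "arc_lipschitz D f" "pcas x p y" "set p \<subseteq> parcs D"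
  shows "f y - f x \<le> real (length p)"
  using assms(2,3)
proof (induction p arbitrary: x)
  case (Cons e p)
  have "f (snd e) \<le> f (fst e) + 1"
    using Cons.prems assms(1) by (cases e) (auto simp: arc_lipschitz_def)
  then show ?case
    using Cons.IH[of "snd e"] Cons.prems by auto
qed auto

text \<open>Growth telescopes along every path; if there is no path, the distance is
  infinite.\<close>

lemma arc_lipschitz_le_ddist:
  assumes "arc_lipschitz D f"
  shows "ereal (f y - f x) \<le> ddist D x y"
  unfolding ddist_def
  by (intro INF_greatest)
    (auto simp: pre_digraph.apath_def pre_digraph.awalk_def cas_with_proj_eq
      intro!: arc_lipschitz_pcas[OF assms])

lemma ddist_nonneg: "0 \<le> ddist D x y"
  unfolding ddist_def by (intro INF_greatest) auto

section \<open>Couplings with finitely supported marginals\<close>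

lemma is_coupling_finite_marginals:
  assumes A: "is_coupling V \<mu> \<nu> A"
    and S: "finite S" "S \<subseteq> V" "\<And>u. u \<in> V - S \<Longrightarrow> \<mu> u = 0"
    and T: "finite T" "T \<subseteq> V" "\<And>v. v \<in> V - T \<Longrightarrow> \<nu> v = 0"
  shows "\<And>u v. u \<in> V \<Longrightarrow> v \<in> V \<Longrightarrow> u \<notin> S \<or> v \<notin> T \<Longrightarrow> A u v = 0"
    and "\<And>u. u \<in> V \<Longrightarrow> (\<Sum>v\<in>T. A u v) = \<mu> u"
    and "\<And>v. v \<in> V \<Longrightarrow> (\<Sum>u\<in>S. A u v) = \<nu> v"
proof -
  have nonneg: "0 \<le> A u v" if "u \<in> V" "v \<in> V" for u v
    using A that by (auto simp: is_coupling_def)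
  have rows: "((\<lambda>v. A u v) has_sum \<mu> u) V" if "u \<in> V" for u
    using A that by (auto simp: is_coupling_def)
  have cols: "((\<lambda>u. A u v) has_sum \<nu> v) V" if "v \<in> V" for v
    using A that by (auto simp: is_coupling_def)
  \<comment> \<open>Nonnegative entries with total 0 all vanish, which confines \<open>A\<close> to
    \<open>S \<times> T\<close> even if \<open>V\<close> is infinite.\<close>
  have row0: "A u v = 0" if "u \<in> V - S" "v \<in> V" for u v
    using nonneg_has_sum_le_0D[OF rows[of u], of v] nonneg S(3)[of u] that by auto
  have col0: "A u v = 0" if "v \<in> V - T" "u \<in> V" for u v
    using nonneg_has_sum_le_0D[OF cols[of v], of u] nonneg T(3)[of v] that by auto
  show "A u v = 0" if "u \<in> V" "v \<in> V" "u \<notin> S \<or> v \<notin> T" for u v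
    using that row0 col0 by auto
  show "(\<Sum>v\<in>T. A u v) = \<mu> u" if u: "u \<in> V" for u
  proof -
    have "((\<lambda>v. A u v) has_sum \<mu> u) T"
      using rows[OF u] by (rule has_sum_cong_neutral[THEN iffD1, rotated -1]) (use T u col0 in auto)
    then show ?thesis using T(1) has_sum_finite has_sum_unique by blast
  qed
  show "(\<Sum>u\<in>S. A u v) = \<nu> v" if v: "v \<in> V" for v
  proof -
    have "((\<lambda>u. A u v) has_sum \<nu> v) S"
      using cols[OF v] by (rule has_sum_cong_neutral[THEN iffD1, rotated -1]) (use S v row0 in auto)
    then show ?thesis using S(1) has_sum_finite has_sum_unique by blast
  qed
qed

text \<open>The expected growth of \<open>f\<close> depends only on the two marginals, so it is the
  same for every coupling. This common value is the dual objective.\<close>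

lemma coupling_potential_sum:
  assumes A: "is_coupling V \<mu> \<nu> A"
    and S: "finite S" "S \<subseteq> V" "\<And>u. u \<in> V - S \<Longrightarrow> \<mu> u = 0"
    and T: "finite T" "T \<subseteq> V" "\<And>v. v \<in> V - T \<Longrightarrow> \<nu> v = 0"
  shows "(\<Sum>(u, v)\<in>S \<times> T. A u v * (f v - f u)) = (\<Sum>v\<in>T. \<nu> v * f v) - (\<Sum>u\<in>S. \<mu> u * f u)"
proof -
  note marg = is_coupling_finite_marginals[OF assms]
  have "(\<Sum>(u, v)\<in>S \<times> T. A u v * (f v - f u)) =
      (\<Sum>u\<in>S. \<Sum>v\<in>T. A u v * f v) - (\<Sum>u\<in>S. (\<Sum>v\<in>T. A u v) * f u)"
    by (simp add: sum.cartesian_product[symmetric] right_diff_distrib sum_subtractf sum_distrib_right)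
  also have "(\<Sum>u\<in>S. (\<Sum>v\<in>T. A u v) * f u) = (\<Sum>u\<in>S. \<mu> u * f u)"
    using S marg(2) by (intro sum.cong) auto
  also have "(\<Sum>u\<in>S. \<Sum>v\<in>T. A u v * f v) = (\<Sum>v\<in>T. (\<Sum>u\<in>S. A u v) * f v)"
    by (subst sum.swap) (simp add: sum_distrib_right)
  also have "\<dots> = (\<Sum>v\<in>T. \<nu> v * f v)"
    using T marg(3) by (intro sum.cong) auto
  finally show ?thesis .
qed

text \<open>Kantorovich duality with complementary slackness: a coupling that only moves mass along pairs
  on which the Lipschitz function grows by the full distance is optimal.\<close>

lemma wasserstein_eqI:
  assumes A: "is_coupling (pverts D) \<mu> \<nu> A"
    and S: "finite S" "S \<subseteq> pverts D" "\<And>u. u \<in> pverts D - S \<Longrightarrow> \<mu> u = 0"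
    and T: "finite T" "T \<subseteq> pverts D" "\<And>v. v \<in> pverts D - T \<Longrightarrow> \<nu> v = 0"
    and f: "arc_lipschitz D f"
    and tight: "\<And>u v. u \<in> S \<Longrightarrow> v \<in> T \<Longrightarrow> A u v \<noteq> 0 \<Longrightarrow> ddist D u v \<le> ereal (f v - f u)"
  shows "wasserstein D \<mu> \<nu> = ereal ((\<Sum>v\<in>T. \<nu> v * f v) - (\<Sum>u\<in>S. \<mu> u * f u))"
proof -
  let ?V = "pverts D" and ?W = "(\<Sum>v\<in>T. \<nu> v * f v) - (\<Sum>u\<in>S. \<mu> u * f u)"
  let ?cost = "\<lambda>B. \<Sum>\<^sub>\<infinity>(u, v) \<in> ?V \<times> ?V. ereal (B u v) * ddist D u v"
  have nonneg: "0 \<le> B u v" if "is_coupling ?V \<mu> \<nu> B" "u \<in> S" "v \<in> T" for B u v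
    using that S(2) T(2) unfolding is_coupling_def by (meson subsetD)
  have cost: "?cost B = (\<Sum>(u, v)\<in>S \<times> T. ereal (B u v) * ddist D u v)"
    if B: "is_coupling ?V \<mu> \<nu> B" for B
  proof -
    have "?cost B = (\<Sum>\<^sub>\<infinity>(u, v) \<in> S \<times> T. ereal (B u v) * ddist D u v)"
    proof (rule infsum_cong_neutral)
      fix p assume "p \<in> ?V \<times> ?V - S \<times> T"
      then have "B (fst p) (snd p) = 0"
        by (intro is_coupling_finite_marginals(1)[OF B S T]) auto
      then show "(case p of (u, v) \<Rightarrow> ereal (B u v) * ddist D u v) = 0"
        by (simp add: case_prod_beta)
    qed (use S T in auto)
    then show ?thesis using S(1) T(1) by simp
  qed
  have W: "ereal ?W = (\<Sum>(u, v)\<in>S \<times> T. ereal (B u v * (f v - f u)))"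
    if B: "is_coupling ?V \<mu> \<nu> B" for B
    using coupling_potential_sum[OF B S T, of f, symmetric]
    by (simp add: case_prod_beta' sum_ereal)
  have lower: "ereal ?W \<le> ?cost B" if B: "is_coupling ?V \<mu> \<nu> B" for B
    unfolding cost[OF B] W[OF B]
  proof (rule sum_mono, safe)
    fix u v assume "u \<in> S" "v \<in> T"
    with B have "0 \<le> B u v" by (rule nonneg)
    then show "ereal (B u v * (f v - f u)) \<le> ereal (B u v) * ddist D u v"
      using ereal_mult_left_mono[OF arc_lipschitz_le_ddist[OF f, of v u], of "ereal (B u v)"] by simp
  qed
  \<comment> \<open>Where \<open>A\<close> moves no mass, \<open>tight\<close> gives nothing and the
    distance may be infinite; the summand is then 0 by the convention for
    \<open>0 * \<infinity>\<close>.\<close>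
  have upper: "?cost A \<le> ereal ?W"
    unfolding cost[OF A] W[OF A]
  proof (rule sum_mono, safe)
    fix u v assume uv: "u \<in> S" "v \<in> T"
    with A have "0 \<le> A u v" by (rule nonneg)
    then show "ereal (A u v) * ddist D u v \<le> ereal (A u v * (f v - f u))"
      using ereal_mult_left_mono[OF tight[OF uv], of "ereal (A u v)"]
      by (cases "A u v = 0") (auto simp: zero_ereal_def[symmetric])
  qed
  show ?thesis
    unfolding wasserstein_def
  proof (rule antisym)
    show "(INF B\<in>{B. is_coupling ?V \<mu> \<nu> B}. ?cost B) \<le> ereal ?W"
      using A upper by (intro INF_lower2[of A]) auto
    show "ereal ?W \<le> (INF B\<in>{B. is_coupling ?V \<mu> \<nu> B}. ?cost B)"
      using lower by (intro INF_greatest) auto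
  qed
qed

section \<open>Curvature from a matching of closed out-balls\<close>

lemma lazy_walk_wasserstein_matching:
  fixes D :: "'v pair_pre_digraph" and d :: nat and \<alpha> :: real
  defines "\<epsilon> \<equiv> (1 - \<alpha>) / real d"
    and "X \<equiv> \<lambda>x. insert x (out_nbrs D x)"
  assumes xy: "x \<in> pverts D" "y \<in> pverts D"
    and d: "card (out_nbrs D x) = d" "card (out_nbrs D y) = d" "0 < d"
    and noloop: "x \<notin> out_nbrs D x" "y \<notin> out_nbrs D y"
    and \<sigma>: "bij_betw \<sigma> (X x) (X y)"
    and f: "arc_lipschitz D f"
    and dxy: "ddist D x y \<le> ereal (f y - f x)"
    and tight: "\<And>u. u \<in> X x \<Longrightarrow> ddist D u (\<sigma> u) \<le> ereal (f (\<sigma> u) - f u)"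
    and \<alpha>: "\<epsilon> \<le> \<alpha>" "\<alpha> \<le> 1"
  shows "wasserstein D (lazy_walk D \<alpha> x) (lazy_walk D \<alpha> y) =
    ereal ((\<alpha> - \<epsilon>) * (f y - f x) + \<epsilon> * (\<Sum>u\<in>X x. f (\<sigma> u) - f u))"
proof -
  \<comment> \<open>The two terms are added because \<open>\<sigma> x = y\<close> is allowed, and
    then both charge the pair \<open>(x, y)\<close>; even there the entry is only \<alpha>, hence at
    most 1.\<close>
  define A where "A u v = (\<alpha> - \<epsilon>) * of_bool (u = x \<and> v = y) + \<epsilon> * of_bool (u \<in> X x \<and> v = \<sigma> u)" for u v
  have \<epsilon>0: "0 \<le> \<epsilon>" using \<alpha> by (simp add: \<epsilon>_def)
  have fin: "finite (X x)" "finite (X y)"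
    using d by (auto simp: X_def intro: card_ge_0_finite)
  have sub: "X x \<subseteq> pverts D" "X y \<subseteq> pverts D"
    using xy by (auto simp: X_def out_nbrs_def)
  have self: "x \<in> X x" "y \<in> X y" by (auto simp: X_def)
  \<comment> \<open>Either walk gives \<epsilon> to each point of its closed out-ball and a surplus
    \<alpha> - \<epsilon> to the centre, so matching the balls and moving the surplus yields a
    coupling.\<close>
  have walk: "lazy_walk D \<alpha> z v = (\<alpha> - \<epsilon>) * of_bool (v = z) + \<epsilon> * of_bool (v \<in> X z)"
    if "z = x \<or> z = y" "v \<in> pverts D" for z v
    using that noloop d by (auto simp: lazy_walk_def X_def \<epsilon>_def out_nbrs_def)
  have \<sigma>_in: "\<sigma> u \<in> X y" if "u \<in> X x" for u
    using \<sigma> that by (auto simp: bij_betw_def)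
  have row: "(\<Sum>v\<in>X y. A u v) = (\<alpha> - \<epsilon>) * of_bool (u = x) + \<epsilon> * of_bool (u \<in> X x)" for u
    using fin self \<sigma>_in
    by (cases "u \<in> X x"; cases "u = x")
      (auto simp: A_def sum.distrib of_bool_def sum_distrib_left[symmetric])
  have inv: "(\<Sum>u\<in>X x. of_bool (v = \<sigma> u)) = (of_bool (v \<in> X y) :: real)" for v
  proof -
    have "(\<Sum>u\<in>X x. of_bool (v = \<sigma> u)) = (\<Sum>w\<in>X y. of_bool (v = w) :: real)"
      by (rule sum.reindex_bij_betw[OF \<sigma>])
    then show ?thesis using fin by (auto simp: of_bool_def)
  qed
  have col: "(\<Sum>u\<in>X x. A u v) = (\<alpha> - \<epsilon>) * of_bool (v = y) + \<epsilon> * of_bool (v \<in> X y)" for v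
  proof -
    have "(\<Sum>u\<in>X x. A u v) =
        (\<alpha> - \<epsilon>) * (\<Sum>u\<in>X x. of_bool (u = x \<and> v = y)) + \<epsilon> * (\<Sum>u\<in>X x. of_bool (v = \<sigma> u))"
      by (simp add: A_def sum.distrib sum_distrib_left)
    moreover have "(\<Sum>u\<in>X x. of_bool (u = x \<and> v = y)) = (of_bool (v = y) :: real)"
      using fin self by (cases "v = y") (auto simp: of_bool_def)
    ultimately show ?thesis by (simp only: inv)
  qed
  have coupling: "is_coupling (pverts D) (lazy_walk D \<alpha> x) (lazy_walk D \<alpha> y) A"
    unfolding is_coupling_def
  proof (intro conjI ballI)
    fix u v assume uv: "u \<in> pverts D" "v \<in> pverts D"
    show "0 \<le> A u v" "A u v \<le> 1"
      using \<alpha> \<epsilon>0 by (auto simp: A_def)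
    have "(A u has_sum sum (A u) (X y)) (X y)" using fin by simp
    then have "(A u has_sum sum (A u) (X y)) (pverts D)"
      by (rule has_sum_cong_neutral[THEN iffD1, rotated -1])
        (use sub self \<sigma>_in in \<open>auto simp: A_def\<close>)
    then show "(A u has_sum lazy_walk D \<alpha> x u) (pverts D)"
      using walk uv by (simp add: row)
    have "((\<lambda>u. A u v) has_sum (\<Sum>u\<in>X x. A u v)) (X x)" using fin by simp
    then have "((\<lambda>u. A u v) has_sum (\<Sum>u\<in>X x. A u v)) (pverts D)"
      by (rule has_sum_cong_neutral[THEN iffD1, rotated -1])
        (use sub self in \<open>auto simp: A_def\<close>)
    then show "((\<lambda>u. A u v) has_sum lazy_walk D \<alpha> y v) (pverts D)"
      using walk uv by (simp add: col)
  qed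
  have "wasserstein D (lazy_walk D \<alpha> x) (lazy_walk D \<alpha> y) =
      ereal ((\<Sum>v\<in>X y. lazy_walk D \<alpha> y v * f v) - (\<Sum>u\<in>X x. lazy_walk D \<alpha> x u * f u))"
  proof (rule wasserstein_eqI[OF coupling fin(1) sub(1) _ fin(2) sub(2) _ f])
    fix u v assume "u \<in> X x" "v \<in> X y" "A u v \<noteq> 0"
    then have "u = x \<and> v = y \<or> v = \<sigma> u" by (auto simp: A_def of_bool_def split: if_splits)
    then show "ddist D u v \<le> ereal (f v - f u)"
      using dxy tight \<open>u \<in> X x\<close> by auto
  qed (use walk self in auto)
  moreover have mass: "(\<Sum>u\<in>X z. lazy_walk D \<alpha> z u * f u) = (\<alpha> - \<epsilon>) * f z + \<epsilon> * (\<Sum>u\<in>X z. f u)"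
    if z: "z = x \<or> z = y" for z
  proof -
    have "(\<Sum>u\<in>X z. lazy_walk D \<alpha> z u * f u) =
        (\<Sum>u\<in>X z. (\<alpha> - \<epsilon>) * (of_bool (u = z) * f u) + \<epsilon> * f u)"
    proof (rule sum.cong[OF refl])
      fix u assume u: "u \<in> X z"
      then have "u \<in> pverts D" using z sub by auto
      then show "lazy_walk D \<alpha> z u * f u = (\<alpha> - \<epsilon>) * (of_bool (u = z) * f u) + \<epsilon> * f u"
        by (subst walk[OF z]) (simp_all add: u algebra_simps)
    qed
    also have "\<dots> = (\<alpha> - \<epsilon>) * (\<Sum>u\<in>X z. of_bool (u = z) * f u) + \<epsilon> * (\<Sum>u\<in>X z. f u)"
      by (simp add: sum.distrib sum_distrib_left)
    also have "(\<Sum>u\<in>X z. of_bool (u = z) * f u) = f z"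
      using z fin self sum.delta[of "X z" z f]
      by (auto simp: of_bool_def if_distribR if_distrib[of "\<lambda>t. t * _"] cong: if_cong)
    finally show ?thesis .
  qed
  \<comment> \<open>Reindexing by \<sigma> turns the difference of the two integrals of
    \<open>f\<close> into growth along the matching.\<close>
  moreover have "(\<Sum>v\<in>X y. f v) = (\<Sum>u\<in>X x. f (\<sigma> u))"
    by (rule sum.reindex_bij_betw[OF \<sigma>, symmetric])
  ultimately show ?thesis
    by (simp add: mass[of x] mass[of y] sum_subtractf right_diff_distrib)
qed

text \<open>The transport cost is affine in \<alpha> near 1, and dividing by 1 - \<alpha> cancels
  the dependence on \<alpha>; the limit is that of an eventually constant function.\<close>

lemma has_lly_curvature_matching:
  fixes D :: "'v pair_pre_digraph" and d :: nat
  assumes xy: "x \<in> pverts D" "y \<in> pverts D"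
    and d: "card (out_nbrs D x) = d" "card (out_nbrs D y) = d" "0 < d"
    and noloop: "x \<notin> out_nbrs D x" "y \<notin> out_nbrs D y"
    and \<sigma>: "\<sigma> ` insert x (out_nbrs D x) = insert y (out_nbrs D y)"
    and f: "arc_lipschitz D f"
    and dxy: "ddist D x y \<le> 1" "f y - f x = 1"
    and tight: "\<And>u. u \<in> insert x (out_nbrs D x) \<Longrightarrow> ddist D u (\<sigma> u) \<le> ereal (f (\<sigma> u) - f u)"
  shows "has_lly_curvature D x y (1 + (1 - (\<Sum>u\<in>insert x (out_nbrs D x). f (\<sigma> u) - f u)) / d)"
    (is "has_lly_curvature D x y (1 + (1 - ?c) / d)")
proof -
  have fin: "finite (out_nbrs D x)" "finite (out_nbrs D y)"
    using d by (auto intro: card_ge_0_finite)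
  then have "card (insert x (out_nbrs D x)) = card (insert y (out_nbrs D y))"
    using d noloop by simp
  \<comment> \<open>A surjection between finite sets of equal size is a bijection.\<close>
  then have bij: "bij_betw \<sigma> (insert x (out_nbrs D x)) (insert y (out_nbrs D y))"
    using fin \<sigma> by (intro bij_betw_imageI eq_card_imp_inj_on) auto
  show ?thesis
    unfolding has_lly_curvature_def
  proof (rule tendsto_eventually)
    \<comment> \<open>Since \<open>d\<close> is at least 1, \<alpha> > 1/2 gives \<epsilon> \<le> 1
      - \<alpha> < \<alpha>, so the surplus at the centre is nonnegative.\<close>
    have "\<forall>\<^sub>F \<alpha> in at_left (1::real). 1 / 2 < \<alpha> \<and> \<alpha> < 1"
      unfolding eventually_at_left_field by (intro exI[of _ "1 / 2"]) auto
    then show "\<forall>\<^sub>F \<alpha> in at_left 1.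
        lazy_curvature D \<alpha> x y / ereal (1 - \<alpha>) = ereal (1 + (1 - ?c) / d)"
    proof eventually_elim
      case (elim \<alpha>)
      define \<epsilon> where "\<epsilon> = (1 - \<alpha>) / real d"
      have "\<epsilon> \<le> (1 - \<alpha>) / 1" unfolding \<epsilon>_def using d(3) elim by (intro divide_left_mono) auto
      then have "\<epsilon> \<le> \<alpha>" using elim by simp
      moreover have dist: "ddist D x y = 1"
        using arc_lipschitz_le_ddist[OF f, of y x] dxy by (auto simp: one_ereal_def)
      ultimately have "wasserstein D (lazy_walk D \<alpha> x) (lazy_walk D \<alpha> y) = ereal (\<alpha> - \<epsilon> + \<epsilon> * ?c)"
        using lazy_walk_wasserstein_matching[OF xy d noloop bij f _ tight, of \<alpha>] dxy elim
        by (simp add: \<epsilon>_def one_ereal_def)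
      then have "lazy_curvature D \<alpha> x y = ereal ((1 - \<alpha>) * (1 + (1 - ?c) / d))"
        by (simp add: lazy_curvature_def dist one_ereal_def \<epsilon>_def algebra_simps diff_divide_distrib)
      then show ?case using elim by simp
    qed
  qed
qed

section \<open>Distances in Cayley digraphs\<close>

lemma (in group) out_nbrs_cayley_digraph:
  assumes "S \<subseteq> carrier G" "x \<in> carrier G"
  shows "out_nbrs (cayley_digraph G S) x = (\<otimes>) x ` S"
  using assms by (auto simp: out_nbrs_def cayley_digraph_def)

lemma (in group) card_out_nbrs_cayley_digraph:
  assumes "S \<subseteq> carrier G" "x \<in> carrier G"
  shows "card (out_nbrs (cayley_digraph G S) x) = card S"
  unfolding out_nbrs_cayley_digraph[OF assms]
  using assms by (intro card_image inj_onI) (metis Units_eq Units_l_cancel subsetD)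

lemma (in group) cayley_digraph_loopfree:
  assumes "S \<subseteq> carrier G - {\<one>}" "x \<in> carrier G"
  shows "x \<notin> out_nbrs (cayley_digraph G S) x"
proof
  assume "x \<in> out_nbrs (cayley_digraph G S) x"
  then obtain s where s: "s \<in> S" "x = x \<otimes> s"
    using assms by (subst (asm) out_nbrs_cayley_digraph) auto
  with assms have "s = \<one>" using l_cancel_one'[of x s] by auto
  then show False using assms s by auto
qed

lemma (in group) awalk_cayley_digraph:
  assumes "S \<subseteq> carrier G" "x \<in> carrier G" "set ss \<subseteq> S"
  shows "\<exists>p. pre_digraph.awalk (with_proj (cayley_digraph G S)) x p (foldl (\<otimes>) x ss)
    \<and> length p = length ss"
  using assms(2,3)
proof (induction ss arbitrary: x)
  case Nil
  then show ?case
    by (intro exI[of _ "[]"])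
      (simp add: pre_digraph.awalk_def cas_with_proj_eq cayley_digraph_def)
next
  case (Cons s ss)
  then have "x \<otimes> s \<in> carrier G" using assms(1) by auto
  then obtain p where "pre_digraph.awalk (with_proj (cayley_digraph G S)) (x \<otimes> s) p
      (foldl (\<otimes>) (x \<otimes> s) ss)" "length p = length ss"
    using Cons by auto
  then show ?case
    using Cons.prems
    by (intro exI[of _ "(x, x \<otimes> s) # p"])
      (auto simp: pre_digraph.awalk_def cas_with_proj_eq cayley_digraph_def)
qed

text \<open>A word in the generators spells a walk, so explicit factorizations bound distances from
  above; potentials supply the lower bounds.\<close>

lemma (in group) ddist_cayley_digraph_le:
  assumes "S \<subseteq> carrier G" "x \<in> carrier G" "set ss \<subseteq> S"
  shows "ddist (cayley_digraph G S) x (foldl (\<otimes>) x ss) \<le> ereal (real (length ss))"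
proof -
  have "pair_wf_digraph (cayley_digraph G S)"
    using assms(1) by unfold_locales (auto simp: cayley_digraph_def)
  then have wf: "wf_digraph (with_proj (cayley_digraph G S))"
    by (simp add: wf_digraph_wp_iff)
  obtain p where "pre_digraph.awalk (with_proj (cayley_digraph G S)) x p (foldl (\<otimes>) x ss)"
    "length p = length ss"
    using awalk_cayley_digraph[OF assms] by blast
  with ddist_le_awalk_length[OF wf this(1)] show ?thesis
    by simp
qed

section \<open>Coordinates on the generalized quaternion group\<close>

text \<open>The state \<open>(i, j)\<close> stands for \<open>a\<^sup>i b\<^sup>j\<close> with \<open>i\<close> read modulo \<open>2 * m\<close>, and a letter acts
  by right multiplication.\<close>

fun quat_step :: "nat \<Rightarrow> int \<times> bool \<Rightarrow> quat_gen \<times> bool \<Rightarrow> int \<times> bool" where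
  "quat_step m (i, j) (Gen_a, s) = (if j = s then i + 1 else i - 1, j)"
| "quat_step m (i, False) (Gen_b, s) = (if s then i - int m else i, True)"
| "quat_step m (i, True) (Gen_b, s) = (if s then i else i + int m, False)"

text \<open>Kept apart from \<open>quat_step\<close>, so that the action of a letter is plain
  integer arithmetic.\<close>

definition quat_norm :: "nat \<Rightarrow> int \<times> bool \<Rightarrow> int \<times> bool" where
  "quat_norm m = (\<lambda>(i, j). (i mod (2 * int m), j))"

lemma quat_norm_idem: "quat_norm m (quat_norm m st) = quat_norm m st"
  by (simp add: quat_norm_def split: prod.split)

lemma quat_norm_step_cong:
  assumes "quat_norm m st = quat_norm m st'"
  shows "quat_norm m (quat_step m st l) = quat_norm m (quat_step m st' l)"
proof -
  obtain i j where st: "st = (i, j)" by force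
  obtain i' where st': "st' = (i', j)" "i mod (2 * int m) = i' mod (2 * int m)"
    using assms by (cases st') (auto simp: st quat_norm_def)
  obtain g s where l: "l = (g, s)" by force
  show ?thesis
    using st'(2) by (cases g; cases j; cases s)
      (auto simp: st st'(1) l quat_norm_def intro: mod_add_cong mod_diff_cong)
qed

lemma quat_norm_foldl_cong:
  "quat_norm m st = quat_norm m st' \<Longrightarrow>
    quat_norm m (foldl (quat_step m) st w) = quat_norm m (foldl (quat_step m) st' w)"
proof (induction w arbitrary: st st')
  case (Cons l w)
  show ?case using Cons.IH[OF quat_norm_step_cong[OF Cons.prems]] by simp
qed simp

text \<open>The sign flips on the coset of \<open>b\<close> because moving a past b to the left
  inverts it.\<close>

lemma foldl_quat_step_power:
  "foldl (quat_step m) (i, j) (replicate k (Gen_a, False)) = (if j then i - int k else i + int k, j)"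
  by (induction k arbitrary: i) (auto simp: algebra_simps)

text \<open>Each defining relation acts trivially from every state, so distinct coordinates certify
  distinct elements. The start state is arbitrary because in a concatenation the second word starts
  where the first ends.\<close>

lemma quat_norm_foldl_pres_eq:
  assumes "pres_eq (quat_relations m) u v"
  shows "quat_norm m (foldl (quat_step m) st u) = quat_norm m (foldl (quat_step m) st v)"
  using assms
proof (induction arbitrary: st rule: pres_eq.induct)
  case (pres_append u u' v v')
  show ?case
    using pres_append.IH(2) quat_norm_foldl_cong[OF pres_append.IH(1)] by simp
next
  case (pres_cancel x s)
  obtain i j where "st = (i, j)" by force
  then show ?case by (cases x; cases j; cases s) auto
next
  case (pres_rel u v)
  obtain i j where st: "st = (i, j)" by force
  \<comment> \<open>On the coset of \<open>b\<close>, the word b b adds \<open>m\<close> to the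
    exponent while a^m subtracts \<open>m\<close>; these agree modulo \<open>2 * m\<close>.\<close>
  have "(i - int m) mod (2 * int m) = (i + int m) mod (2 * int m)"
    using mod_add_self2[of "i - int m" "2 * int m"] by (simp add: algebra_simps)
  moreover have "(i - 2 * int m) mod (2 * int m) = i mod (2 * int m)"
    using mod_add_self2[of "i - 2 * int m" "2 * int m"] by simp
  ultimately show ?case
    using pres_rel
    by (cases j) (auto simp: quat_relations_def st foldl_quat_step_power quat_norm_def)
qed auto

text \<open>The exponents are read off a representative word started at the identity; the choice is
  harmless because the normalized state is invariant under \<open>pres_eq\<close>.\<close>

definition quat_coord :: "nat \<Rightarrow> quat_gen word set \<Rightarrow> int \<times> bool" where
  "quat_coord m X = quat_norm m (foldl (quat_step m) (0, False)
     (SOME u. X = pres_class (quat_relations m) u))"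

lemma quat_coord_pres_class:
  "quat_coord m (pres_class (quat_relations m) u) = quat_norm m (foldl (quat_step m) (0, False) u)"
proof -
  have "pres_class (quat_relations m) u = pres_class (quat_relations m)
      (SOME v. pres_class (quat_relations m) u = pres_class (quat_relations m) v)"
    by (rule someI[of _ u]) simp
  then have "pres_eq (quat_relations m) u
      (SOME v. pres_class (quat_relations m) u = pres_class (quat_relations m) v)"
    by (simp add: pres_class_eq_iff)
  then show ?thesis
    unfolding quat_coord_def by (rule quat_norm_foldl_pres_eq[symmetric])
qed

lemma quat_coord_mult:
  assumes "X \<in> carrier (quaternion_group m)"
  shows "quat_coord m (X \<otimes>\<^bsub>quaternion_group m\<^esub> pres_class (quat_relations m) w) =
    quat_norm m (foldl (quat_step m) (quat_coord m X) w)"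
proof -
  obtain u where "X = pres_class (quat_relations m) u"
    using assms by (auto simp: quaternion_group_def presented_group_simps)
  then show ?thesis
    by (simp add: quaternion_group_def presented_group_mult quat_coord_pres_class)
      (rule quat_norm_foldl_cong, simp add: quat_norm_idem)
qed

lemma quat_norm_coord: "quat_norm m (quat_coord m X) = quat_coord m X"
  by (simp add: quat_coord_def quat_norm_idem)

section \<open>Inverses, powers and relations inside the group\<close>

lemma quat_inv_a: "inv\<^bsub>quaternion_group m\<^esub> (quat_a m) = pres_class (quat_relations m) word_a_inv"
proof (rule group.inv_equality[OF group_quaternion_group])
  show "pres_class (quat_relations m) word_a_inv \<otimes>\<^bsub>quaternion_group m\<^esub> quat_a m =
      \<one>\<^bsub>quaternion_group m\<^esub>"
    using pres_cancel[of "quat_relations m" Gen_a True]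
    by (simp add: quat_a_def quaternion_group_def presented_group_mult presented_group_simps
        pres_class_eq_iff)
qed (auto simp: quat_gens_in_carrier, auto simp: quaternion_group_def presented_group_simps)

lemma quat_inv_b: "inv\<^bsub>quaternion_group m\<^esub> (quat_b m) = pres_class (quat_relations m) word_b_inv"
proof (rule group.inv_equality[OF group_quaternion_group])
  show "pres_class (quat_relations m) word_b_inv \<otimes>\<^bsub>quaternion_group m\<^esub> quat_b m =
      \<one>\<^bsub>quaternion_group m\<^esub>"
    using pres_cancel[of "quat_relations m" Gen_b True]
    by (simp add: quat_b_def quaternion_group_def presented_group_mult presented_group_simps
        pres_class_eq_iff)
qed (auto simp: quat_gens_in_carrier, auto simp: quaternion_group_def presented_group_simps)

lemma quat_a_pow:
  "quat_a m [^]\<^bsub>quaternion_group m\<^esub> (k::nat) =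
    pres_class (quat_relations m) (concat (replicate k word_a))"
proof (induction k)
  case 0
  then show ?case by (simp add: quaternion_group_def presented_group_simps nat_pow_def)
next
  case (Suc k)
  have "concat (replicate k word_a) @ word_a = concat (replicate (Suc k) word_a)"
    by (simp add: replicate_append_same)
  then show ?case
    using Suc monoid.nat_pow_Suc[OF group.is_monoid[OF group_quaternion_group]]
    by (simp add: quat_a_def quaternion_group_def presented_group_mult del: replicate_Suc)
qed

lemma quat_rels:
  fixes m :: nat
  defines "Q \<equiv> quaternion_group m" and "a \<equiv> quat_a m" and "b \<equiv> quat_b m"
  shows "a [^]\<^bsub>Q\<^esub> (2 * m) = \<one>\<^bsub>Q\<^esub>" "b \<otimes>\<^bsub>Q\<^esub> b = a [^]\<^bsub>Q\<^esub> m"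
    and "a \<otimes>\<^bsub>Q\<^esub> b = b \<otimes>\<^bsub>Q\<^esub> inv\<^bsub>Q\<^esub> a" "inv\<^bsub>Q\<^esub> a \<otimes>\<^bsub>Q\<^esub> b = b \<otimes>\<^bsub>Q\<^esub> a"
proof -
  interpret group Q by (simp add: Q_def group_quaternion_group)
  have carr [simp]: "a \<in> carrier Q" "b \<in> carrier Q"
    by (simp_all add: Q_def a_def b_def quat_gens_in_carrier)
  have rel: "pres_class (quat_relations m) u = pres_class (quat_relations m) v"
    if "(u, v) \<in> quat_relations m" for u v
    using that by (simp add: pres_class_eq_iff pres_rel)
  show "a [^]\<^bsub>Q\<^esub> (2 * m) = \<one>\<^bsub>Q\<^esub>"
    unfolding a_def Q_def quat_a_pow
    by (simp only: quaternion_group_def presented_group_simps)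
      (rule rel, simp add: quat_relations_def)
  show "b \<otimes>\<^bsub>Q\<^esub> b = a [^]\<^bsub>Q\<^esub> m"
    unfolding a_def b_def Q_def quat_a_pow
    by (simp only: quaternion_group_def quat_b_def presented_group_mult)
      (rule rel, simp add: quat_relations_def)
  have conj: "inv\<^bsub>Q\<^esub> b \<otimes>\<^bsub>Q\<^esub> (a \<otimes>\<^bsub>Q\<^esub> b) = inv\<^bsub>Q\<^esub> a"
    unfolding a_def b_def Q_def quat_inv_a quat_inv_b
    by (simp only: quaternion_group_def quat_a_def quat_b_def presented_group_mult)
      (rule rel, simp add: quat_relations_def)
  then show ab: "a \<otimes>\<^bsub>Q\<^esub> b = b \<otimes>\<^bsub>Q\<^esub> inv\<^bsub>Q\<^esub> a"
    by (subst (asm) inv_solve_left') auto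
  \<comment> \<open>Multiplying the rule for a b by a on the right gives b = a b a, which determines
    a^-1 b.\<close>
  then have "b = a \<otimes>\<^bsub>Q\<^esub> b \<otimes>\<^bsub>Q\<^esub> a"
    by (subst (asm) inv_solve_right) auto
  then show "inv\<^bsub>Q\<^esub> a \<otimes>\<^bsub>Q\<^esub> b = b \<otimes>\<^bsub>Q\<^esub> a"
    by (subst inv_solve_left') (simp_all only: m_assoc m_closed carr)
qed

section \<open>Potentials in coordinates\<close>

definition quat_potential :: "nat \<Rightarrow> (int \<Rightarrow> real) \<Rightarrow> quat_gen word set \<Rightarrow> real" where
  "quat_potential m h X = h (fst (quat_coord m X)) + of_bool (snd (quat_coord m X))"

text \<open>The letters a and a^-1 shift the index by one, in a direction depending on the coset. An
  arc for b either keeps the index and gains 1 from \<open>of_bool\<close>, or shifts it by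
  \<open>m\<close> and loses that 1, hence the 2 in the third condition.\<close>

lemma quat_potential_arc_lipschitz:
  fixes m :: nat
  defines "Q \<equiv> quaternion_group m" and "a \<equiv> quat_a m" and "b \<equiv> quat_b m" and "n \<equiv> 2 * int m"
  assumes m: "0 < m"
    and h: "\<And>i. 0 \<le> i \<Longrightarrow> i < n \<Longrightarrow> h ((i + 1) mod n) \<le> h i + 1"
      "\<And>i. 0 \<le> i \<Longrightarrow> i < n \<Longrightarrow> h ((i - 1) mod n) \<le> h i + 1"
      "\<And>i. 0 \<le> i \<Longrightarrow> i < n \<Longrightarrow> h ((i + int m) mod n) \<le> h i + 2"
  shows "arc_lipschitz (cayley_digraph Q {a, inv\<^bsub>Q\<^esub> a, b}) (quat_potential m h)"
proof -
  have "quat_potential m h (X \<otimes>\<^bsub>Q\<^esub> s) \<le> quat_potential m h X + 1"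
    if X: "X \<in> carrier Q" and s: "s \<in> {a, inv\<^bsub>Q\<^esub> a, b}" for X s
  proof -
    obtain i j where ij: "quat_coord m X = (i, j)" by force
    then have i: "i mod n = i"
      using quat_norm_coord[of m X] by (simp add: Q_def quat_norm_def n_def)
    then have "0 \<le> i" "i < n"
      using m pos_mod_bound[of n i] pos_mod_sign[of n i] by (auto simp: n_def)
    note hi = h[OF this]
    note coord = quat_coord_mult[OF X[unfolded Q_def], folded Q_def]
    obtain w where w: "s = pres_class (quat_relations m) w" "w \<in> {word_a, word_a_inv, word_b}"
      using s unfolding a_def b_def Q_def quat_inv_a by (auto simp: quat_a_def quat_b_def)
    show ?thesis
      using w(2) hi i by (cases j)
        (auto simp: w(1) quat_potential_def coord ij quat_norm_def n_def[symmetric])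
  qed
  then show ?thesis
    by (auto simp: arc_lipschitz_def cayley_digraph_def)
qed

section \<open>Curvatures of the quaternion Cayley digraph\<close>

text \<open>Replaces the modulus by a case split, so that Lipschitz conditions on piecewise
  potentials become linear arithmetic.\<close>

lemma int_mod_shift:
  fixes n :: int
  assumes "0 \<le> i" "i < n" "0 \<le> k" "k \<le> n"
  shows "(i + k) mod n = (if i + k < n then i + k else i + k - n)"
    and "(i - k) mod n = (if k \<le> i then i - k else i - k + n)"
proof -
  show "(i + k) mod n = (if i + k < n then i + k else i + k - n)"
    using assms minus_mod_self2[of "i + k" n] mod_pos_pos_trivial[of "i + k - n" n] by auto
  show "(i - k) mod n = (if k \<le> i then i - k else i - k + n)"
    using assms mod_add_self2[of "i - k" n] mod_pos_pos_trivial[of "i - k + n" n] by auto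
qed

locale quaternion_cayley =
  fixes m :: nat
  assumes m_ge_2: "2 \<le> m"
begin

abbreviation "Q \<equiv> quaternion_group m"
abbreviation "a \<equiv> quat_a m"
abbreviation "b \<equiv> quat_b m"
abbreviation "S \<equiv> {a, inv\<^bsub>Q\<^esub> a, b}"
abbreviation "\<Gamma> \<equiv> cayley_digraph Q S"
abbreviation "n \<equiv> 2 * int m"

sublocale group Q
  by (rule group_quaternion_group)

lemmas gens_in_carrier [simp] = quat_gens_in_carrier[of m]

lemmas rels = quat_rels[of m]

text \<open>These are all the points of the closed out-balls of e, a and b.\<close>

lemma coord:
  "quat_coord m \<one>\<^bsub>Q\<^esub> = (0, False)" "quat_coord m a = (1, False)"
  "quat_coord m (inv\<^bsub>Q\<^esub> a) = (n - 1, False)" "quat_coord m b = (0, True)"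
  "quat_coord m (a \<otimes>\<^bsub>Q\<^esub> a) = (2, False)" "quat_coord m (a \<otimes>\<^bsub>Q\<^esub> b) = (1, True)"
  "quat_coord m (inv\<^bsub>Q\<^esub> a \<otimes>\<^bsub>Q\<^esub> b) = (n - 1, True)" "quat_coord m (b \<otimes>\<^bsub>Q\<^esub> b) = (int m, False)"
proof -
  \<comment> \<open>The cycle length \<open>n\<close> is at least 4, so 1 and 2 are their own
    residues.\<close>
  have mod_n: "1 mod n = 1" "2 mod n = 2" "(- 1) mod n = n - 1" "int m mod n = int m"
    using m_ge_2 int_mod_shift[of 0 n 1] by auto
  have one: "\<one>\<^bsub>Q\<^esub> = pres_class (quat_relations m) []"
    by (simp add: quaternion_group_def presented_group_simps)
  have mult: "pres_class (quat_relations m) u \<otimes>\<^bsub>Q\<^esub> pres_class (quat_relations m) v =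
      pres_class (quat_relations m) (u @ v)" for u v
    by (simp add: quaternion_group_def presented_group_mult)
  show "quat_coord m \<one>\<^bsub>Q\<^esub> = (0, False)" "quat_coord m a = (1, False)"
    "quat_coord m (inv\<^bsub>Q\<^esub> a) = (n - 1, False)" "quat_coord m b = (0, True)"
    "quat_coord m (a \<otimes>\<^bsub>Q\<^esub> a) = (2, False)" "quat_coord m (a \<otimes>\<^bsub>Q\<^esub> b) = (1, True)"
    "quat_coord m (inv\<^bsub>Q\<^esub> a \<otimes>\<^bsub>Q\<^esub> b) = (n - 1, True)" "quat_coord m (b \<otimes>\<^bsub>Q\<^esub> b) = (int m, False)"
    unfolding quat_inv_a unfolding quat_a_def quat_b_def one mult
    using mod_n by (simp_all add: quat_coord_pres_class quat_norm_def)
qed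

lemma one_gens_distinct:
  "\<one>\<^bsub>Q\<^esub> \<noteq> a" "\<one>\<^bsub>Q\<^esub> \<noteq> inv\<^bsub>Q\<^esub> a" "\<one>\<^bsub>Q\<^esub> \<noteq> b" "a \<noteq> inv\<^bsub>Q\<^esub> a" "a \<noteq> b" "inv\<^bsub>Q\<^esub> a \<noteq> b"
proof -
  have ne_coord: "x \<noteq> y" if "quat_coord m x \<noteq> quat_coord m y" for x y
    using that by auto
  show "\<one>\<^bsub>Q\<^esub> \<noteq> a" "\<one>\<^bsub>Q\<^esub> \<noteq> inv\<^bsub>Q\<^esub> a" "\<one>\<^bsub>Q\<^esub> \<noteq> b" "a \<noteq> inv\<^bsub>Q\<^esub> a" "a \<noteq> b" "inv\<^bsub>Q\<^esub> a \<noteq> b"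
    by ((rule ne_coord, unfold coord, use m_ge_2 in simp)+)
qed

lemma S_props: "S \<subseteq> carrier Q" "S \<subseteq> carrier Q - {\<one>\<^bsub>Q\<^esub>}" "card S = 3"
  using one_gens_distinct by auto

text \<open>The products b a and b a^-1 are rewritten as a^-1 b and a b, whose coordinates are
  known.\<close>

lemma out_nbrs_eq:
  "out_nbrs \<Gamma> \<one>\<^bsub>Q\<^esub> = {a, inv\<^bsub>Q\<^esub> a, b}" "out_nbrs \<Gamma> a = {a \<otimes>\<^bsub>Q\<^esub> a, \<one>\<^bsub>Q\<^esub>, a \<otimes>\<^bsub>Q\<^esub> b}"
  "out_nbrs \<Gamma> b = {inv\<^bsub>Q\<^esub> a \<otimes>\<^bsub>Q\<^esub> b, a \<otimes>\<^bsub>Q\<^esub> b, b \<otimes>\<^bsub>Q\<^esub> b}"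
  by (subst out_nbrs_cayley_digraph; simp add: rels)+

lemma out_nbrs_props:
  assumes "x \<in> carrier Q"
  shows "card (out_nbrs \<Gamma> x) = 3" "x \<notin> out_nbrs \<Gamma> x"
  using card_out_nbrs_cayley_digraph[OF S_props(1) assms]
    cayley_digraph_loopfree[OF S_props(2) assms] S_props(3)
  by simp_all

lemma ddist_le:
  assumes "x \<in> carrier Q"
  shows "ddist \<Gamma> x x \<le> ereal 0"
    and "s \<in> S \<Longrightarrow> ddist \<Gamma> x (x \<otimes>\<^bsub>Q\<^esub> s) \<le> ereal 1"
    and "s \<in> S \<Longrightarrow> t \<in> S \<Longrightarrow> ddist \<Gamma> x (x \<otimes>\<^bsub>Q\<^esub> s \<otimes>\<^bsub>Q\<^esub> t) \<le> ereal 2"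
    and "s \<in> S \<Longrightarrow> t \<in> S \<Longrightarrow> r \<in> S \<Longrightarrow>
      ddist \<Gamma> x (x \<otimes>\<^bsub>Q\<^esub> s \<otimes>\<^bsub>Q\<^esub> t \<otimes>\<^bsub>Q\<^esub> r) \<le> ereal 3"
  using ddist_cayley_digraph_le[OF S_props(1) assms, of "[]"]
    ddist_cayley_digraph_le[OF S_props(1) assms, of "[s]"]
    ddist_cayley_digraph_le[OF S_props(1) assms, of "[s, t]"]
    ddist_cayley_digraph_le[OF S_props(1) assms, of "[s, t, r]"]
  by simp_all

text \<open>The bounds are lengths of words for a^3: it equals a^-1 when a^4 = e, b b when
  \<open>m = 3\<close>, and a a a always.\<close>

lemma ddist_inv_a_a2_le:
  "ddist \<Gamma> (inv\<^bsub>Q\<^esub> a) (a \<otimes>\<^bsub>Q\<^esub> a) \<le> ereal (if m = 2 then 1 else if m = 3 then 2 else 3)"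
proof -
  consider "m = 2" | "m = 3" | "m \<ge> 4" using m_ge_2 by linarith
  then show ?thesis
  proof cases
    case 1
    have "a \<otimes>\<^bsub>Q\<^esub> (a \<otimes>\<^bsub>Q\<^esub> a) \<otimes>\<^bsub>Q\<^esub> a = a [^]\<^bsub>Q\<^esub> (4::nat)"
      by (simp add: numeral_eq_Suc m_assoc)
    also have "\<dots> = \<one>\<^bsub>Q\<^esub>"
      using rels(1) 1 by simp
    finally have "inv\<^bsub>Q\<^esub> a = a \<otimes>\<^bsub>Q\<^esub> (a \<otimes>\<^bsub>Q\<^esub> a)"
      by (intro inv_equality) auto
    then have "inv\<^bsub>Q\<^esub> a \<otimes>\<^bsub>Q\<^esub> inv\<^bsub>Q\<^esub> a = a \<otimes>\<^bsub>Q\<^esub> a"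
      by (subst inv_solve_left') auto
    then show ?thesis
      using ddist_le(2)[OF inv_closed[OF gens_in_carrier(1)], of "inv\<^bsub>Q\<^esub> a"] 1 by simp
  next
    case 2
    have "b \<otimes>\<^bsub>Q\<^esub> b = a [^]\<^bsub>Q\<^esub> (3::nat)"
      using rels(2) 2 by simp
    also have "\<dots> = a \<otimes>\<^bsub>Q\<^esub> (a \<otimes>\<^bsub>Q\<^esub> a)"
      by (simp add: numeral_eq_Suc m_assoc)
    finally have "inv\<^bsub>Q\<^esub> a \<otimes>\<^bsub>Q\<^esub> (b \<otimes>\<^bsub>Q\<^esub> b) = a \<otimes>\<^bsub>Q\<^esub> a"
      by (subst inv_solve_left') auto
    then have "inv\<^bsub>Q\<^esub> a \<otimes>\<^bsub>Q\<^esub> b \<otimes>\<^bsub>Q\<^esub> b = a \<otimes>\<^bsub>Q\<^esub> a"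
      by (subst m_assoc) auto
    then show ?thesis
      using ddist_le(3)[OF inv_closed[OF gens_in_carrier(1)], of b b] 2 by simp
  next
    case 3
    then show ?thesis
      using ddist_le(4)[OF inv_closed[OF gens_in_carrier(1)], of a a a] by simp
  qed
qed

lemma curvature_a:
  "has_lly_curvature \<Gamma> \<one>\<^bsub>Q\<^esub> a (if m = 2 then 2 / 3 else if m = 3 then 1 / 3 else 0)"
proof -
  \<comment> \<open>The rise from index \<open>n - 1\<close> to 2 must be as large as allowed: 1 for
    \<open>m = 2\<close>, where the two are adjacent; 2 for \<open>m = 3\<close>, where they are
    \<open>m\<close> apart; otherwise 3, climbing through 0 and 1. The plateaus 1 and 0 then keep
    unit shifts within 1 and shifts by \<open>m\<close> within 2.\<close>
  define h :: "int \<Rightarrow> real" where "h i = (if i = 0 then 0 else if i = 1 then 1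
    else if i = 2 then (if m = 2 then 1 else 2) else if i = n - 1 then (if m \<ge> 4 then - 1 else 0)
    else if i \<le> int m then 1 else 0)" for i
  define \<sigma> where "\<sigma> u = (if u = inv\<^bsub>Q\<^esub> a then a \<otimes>\<^bsub>Q\<^esub> a else if u = b then a \<otimes>\<^bsub>Q\<^esub> b else u)" for u
  have \<sigma>: "\<sigma> \<one>\<^bsub>Q\<^esub> = \<one>\<^bsub>Q\<^esub>" "\<sigma> a = a" "\<sigma> (inv\<^bsub>Q\<^esub> a) = a \<otimes>\<^bsub>Q\<^esub> a" "\<sigma> b = a \<otimes>\<^bsub>Q\<^esub> b"
    using one_gens_distinct by (simp_all add: \<sigma>_def)
  let ?f = "quat_potential m h"
  have f: "arc_lipschitz \<Gamma> ?f"
    by (rule quat_potential_arc_lipschitz) (use m_ge_2 in \<open>auto simp: int_mod_shift h_def\<close>)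
  have val: "?f \<one>\<^bsub>Q\<^esub> = 0" "?f a = 1" "?f b = 1" "?f (a \<otimes>\<^bsub>Q\<^esub> b) = 2"
    "?f (a \<otimes>\<^bsub>Q\<^esub> a) - ?f (inv\<^bsub>Q\<^esub> a) = (if m = 2 then 1 else if m = 3 then 2 else 3)"
    using m_ge_2 unfolding quat_potential_def coord by (auto simp: h_def)
  have "ddist \<Gamma> b (a \<otimes>\<^bsub>Q\<^esub> b) \<le> ereal 1"
    using ddist_le(2)[of b "inv\<^bsub>Q\<^esub> a"] by (simp add: rels(3))
  then have tight: "\<forall>u\<in>insert \<one>\<^bsub>Q\<^esub> (out_nbrs \<Gamma> \<one>\<^bsub>Q\<^esub>). ddist \<Gamma> u (\<sigma> u) \<le> ereal (?f (\<sigma> u) - ?f u)"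
    using ddist_le(1)[of "\<one>\<^bsub>Q\<^esub>"] ddist_le(1)[of a] ddist_inv_a_a2_le
    by (simp add: out_nbrs_eq \<sigma> val)
  have img: "\<sigma> ` insert \<one>\<^bsub>Q\<^esub> (out_nbrs \<Gamma> \<one>\<^bsub>Q\<^esub>) = insert a (out_nbrs \<Gamma> a)"
    unfolding out_nbrs_eq image_insert \<sigma> by blast
  have "has_lly_curvature \<Gamma> \<one>\<^bsub>Q\<^esub> a
      (1 + (1 - (\<Sum>u\<in>insert \<one>\<^bsub>Q\<^esub> (out_nbrs \<Gamma> \<one>\<^bsub>Q\<^esub>). ?f (\<sigma> u) - ?f u)) / real 3)"
    using ddist_le(2)[of "\<one>\<^bsub>Q\<^esub>" a] val
    by (intro has_lly_curvature_matching out_nbrs_props img f tight[rule_format])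
      (auto simp: cayley_digraph_def one_ereal_def)
  \<comment> \<open>The common points e and a contribute 0 and the move of \<open>b\<close>
    contributes the final 1.\<close>
  also have "(\<Sum>u\<in>insert \<one>\<^bsub>Q\<^esub> (out_nbrs \<Gamma> \<one>\<^bsub>Q\<^esub>). ?f (\<sigma> u) - ?f u) =
      (if m = 2 then 1 else if m = 3 then 2 else 3) + 1"
    using one_gens_distinct by (simp add: out_nbrs_eq \<sigma> val)
  also have "1 + (1 - ((if m = 2 then 1 else if m = 3 then 2 else 3) + 1)) / real 3 =
      (if m = 2 then 2 / 3 else if m = 3 then 1 / 3 else 0)"
    using m_ge_2 by auto
  finally show ?thesis .
qed

lemma curvature_b:
  "has_lly_curvature \<Gamma> \<one>\<^bsub>Q\<^esub> b 0"
proof -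
  \<comment> \<open>The move from e to b^2 = a^m has length 2, so \<open>h\<close> rises by the full
    2 over half the cycle; the value 1 elsewhere is compatible because 0 and \<open>m\<close> are
    not adjacent when \<open>m\<close> is at least 2.\<close>
  define h :: "int \<Rightarrow> real" where "h i = (if i = 0 then 0 else if i = int m then 2 else 1)" for i
  \<comment> \<open>Right multiplication by \<open>b\<close>, rerouted so that the shared point
    \<open>b\<close> stays and the identity goes straight to b b.\<close>
  define \<tau> where "\<tau> u = (if u = b then b else if u = \<one>\<^bsub>Q\<^esub> then b \<otimes>\<^bsub>Q\<^esub> b else u \<otimes>\<^bsub>Q\<^esub> b)" for u
  have \<tau>: "\<tau> \<one>\<^bsub>Q\<^esub> = b \<otimes>\<^bsub>Q\<^esub> b" "\<tau> a = a \<otimes>\<^bsub>Q\<^esub> b" "\<tau> (inv\<^bsub>Q\<^esub> a) = inv\<^bsub>Q\<^esub> a \<otimes>\<^bsub>Q\<^esub> b" "\<tau> b = b"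
    using one_gens_distinct by (simp_all add: \<tau>_def)
  let ?f = "quat_potential m h"
  have f: "arc_lipschitz \<Gamma> ?f"
    by (rule quat_potential_arc_lipschitz) (use m_ge_2 in \<open>auto simp: int_mod_shift h_def\<close>)
  have val: "?f \<one>\<^bsub>Q\<^esub> = 0" "?f a = 1" "?f (inv\<^bsub>Q\<^esub> a) = 1" "?f b = 1" "?f (a \<otimes>\<^bsub>Q\<^esub> b) = 2"
    "?f (inv\<^bsub>Q\<^esub> a \<otimes>\<^bsub>Q\<^esub> b) = 2" "?f (b \<otimes>\<^bsub>Q\<^esub> b) = 2"
    using m_ge_2 unfolding quat_potential_def coord by (auto simp: h_def)
  have tight: "\<forall>u\<in>insert \<one>\<^bsub>Q\<^esub> (out_nbrs \<Gamma> \<one>\<^bsub>Q\<^esub>). ddist \<Gamma> u (\<tau> u) \<le> ereal (?f (\<tau> u) - ?f u)"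
    using ddist_le(1)[of b] ddist_le(3)[of "\<one>\<^bsub>Q\<^esub>" b b] ddist_le(2)[of a b] ddist_le(2)[of "inv\<^bsub>Q\<^esub> a" b]
    by (simp add: out_nbrs_eq \<tau> val)
  have img: "\<tau> ` insert \<one>\<^bsub>Q\<^esub> (out_nbrs \<Gamma> \<one>\<^bsub>Q\<^esub>) = insert b (out_nbrs \<Gamma> b)"
    unfolding out_nbrs_eq image_insert \<tau> by blast
  have "has_lly_curvature \<Gamma> \<one>\<^bsub>Q\<^esub> b
      (1 + (1 - (\<Sum>u\<in>insert \<one>\<^bsub>Q\<^esub> (out_nbrs \<Gamma> \<one>\<^bsub>Q\<^esub>). ?f (\<tau> u) - ?f u)) / real 3)"
    using ddist_le(2)[of "\<one>\<^bsub>Q\<^esub>" b] val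
    by (intro has_lly_curvature_matching out_nbrs_props img f tight[rule_format])
      (auto simp: cayley_digraph_def one_ereal_def)
  \<comment> \<open>The growths are 2 from e, 1 each from a and a^-1, and 0 from b.\<close>
  also have "(\<Sum>u\<in>insert \<one>\<^bsub>Q\<^esub> (out_nbrs \<Gamma> \<one>\<^bsub>Q\<^esub>). ?f (\<tau> u) - ?f u) = 4"
    using one_gens_distinct by (simp add: out_nbrs_eq \<tau> val)
  finally show ?thesis by simp
qed

end

theorem proposition4p3:
  fixes m :: nat
  assumes "m \<ge> 2"
  defines "Q \<equiv> quaternion_group m" and "a \<equiv> quat_a m" and "b \<equiv> quat_b m"
  defines "\<Gamma> \<equiv> cayley_digraph Q {a, inv\<^bsub>Q\<^esub> a, b}"
  shows "has_lly_curvature \<Gamma> \<one>\<^bsub>Q\<^esub> a (if m = 2 then 2 / 3 else if m = 3 then 1 / 3 else 0) \<and>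
         has_lly_curvature \<Gamma> \<one>\<^bsub>Q\<^esub> b 0"
proof -
  interpret quaternion_cayley m by unfold_locales fact
  show ?thesis
    unfolding \<Gamma>_def Q_def a_def b_def by (intro conjI curvature_a curvature_b)
qed

end
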